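(* Let $A$ and $B$ be solutions. If $A\otimes B$ is a solution, then $\gcd(|B|,6)=1$. The opposite implication does not hold: for solutions $A$ and $B$, the condition $\gcd(|B|,6)=1$ does not imply that $A\otimes B$ is a solution.
   Context: A solution of size $N$ (to the $N$-Queens Problem) is a permutation $A$ of $\{1,\dots,N\}$ such that $|i-j|\neq|A(i)-A(j)|$ for all $1\le i<j\le N$; its size is denoted $|A|=N$. The composition $A\otimes B$ of arbitrary solutions $A$ and $B$ is the arrangement obtained by inserting a copy of the board $B$ at each queen position of $A$; explicitly it is the map $C$ on $\{1,\dots,|A||B|\}$ given by $$C(|B|(i-1)+j)=|B|(A(i)-1)+B(j),\qquad 1\le i\le |A|,\ 1\le j\le |B|.$$
   Formalization: The first claim is stated for |A| > 1: if |A| = 1 then A⊗B = B, and B = (2,4,1,3) is a solution with gcd(|B|,6) = 2, so the claim fails as written; the second claim is unchanged. *)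

theory Defs
  imports "HOL-Combinatorics.Permutations"
begin

text \<open>As board sizes are positive, the empty arrangement is not a solution. Differences are taken
  in \<^typ>\<open>int\<close>, because subtraction on \<^typ>\<open>nat\<close> truncates.\<close>

definition queens_solution :: "nat \<Rightarrow> (nat \<Rightarrow> nat) \<Rightarrow> bool" where
  "queens_solution N A \<longleftrightarrow>
     1 \<le> N \<and> A permutes {1..N} \<and>
     (\<forall>i j. 1 \<le> i \<and> i < j \<and> j \<le> N \<longrightarrow>
        \<bar>int i - int j\<bar> \<noteq> \<bar>int (A i) - int (A j)\<bar>)"

text \<open>The arrangement \<open>A \<otimes> B\<close> for \<open>\<bar>A\<bar> = M\<close> and \<open>\<bar>B\<bar> = N\<close>: an argument \<open>k = N * (i - 1) + j\<close>
  with \<open>1 \<le> j \<le> N\<close> is decoded as \<open>i = (k - 1) div N + 1\<close> and \<open>j = (k - 1) mod N + 1\<close>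
  (see \<open>queens_comp_eq\<close> below). Outside \<open>{1..M * N}\<close> it is the identity, as
  \<open>permutes\<close> requires.\<close>

definition queens_comp ::
  "nat \<Rightarrow> (nat \<Rightarrow> nat) \<Rightarrow> nat \<Rightarrow> (nat \<Rightarrow> nat) \<Rightarrow> nat \<Rightarrow> nat" where
  "queens_comp M A N B k =
     (if k \<in> {1..M * N}
      then N * (A ((k - 1) div N + 1) - 1) + B ((k - 1) mod N + 1)
      else k)"

lemma queens_comp_eq:
  assumes "1 \<le> i" "i \<le> M" "1 \<le> j" "j \<le> N"
  shows "queens_comp M A N B (N * (i - 1) + j) = N * (A i - 1) + B j"
proof -
  obtain a where a: "i = Suc a" using assms(1) by (cases i) auto
  obtain b where b: "j = Suc b" using assms(3) by (cases j) auto
  have bN: "b < N" using assms b by simp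
  have "N * a + j \<le> N * a + N" using assms by simp
  also have "\<dots> = N * i" using a by simp
  also have "\<dots> \<le> M * N" using assms by (simp add: mult.commute)
  finally have "N * (i - 1) + j \<in> {1..M * N}" using a b by simp
  then show ?thesis using a b bN by (simp add: queens_comp_def)
qed

end

theory Submission
  imports Defs "HOL-Number_Theory.Cong"
begin

text \<open>
  Two queens attack each other diagonally iff they agree in \<open>A i - i\<close> or in \<open>- A i - i\<close>. In
  \<open>A \<otimes> B\<close> such a diagonal number is \<open>N\<close> times that of the \<open>A\<close>-queen plus that of the
  \<open>B\<close>-queen, up to a constant. A solution \<open>A\<close> with more than one queen always occupies two
  neighbouring diagonals in each direction (\<open>neighbouring_diagonals\<close>). If two queens of \<open>B\<close>
  lay on diagonals exactly \<open>N\<close> apart, this could be compensated by the neighbouring diagonals of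
  \<open>A\<close>, and \<open>A \<otimes> B\<close> would contain an attack. As the diagonal numbers of an \<open>N\<close>-board span less
  than \<open>2 * N\<close>, \<open>B\<close> is therefore a solution on the torus: its diagonal numbers are pairwise
  incongruent modulo \<open>N\<close>, in both directions (\<open>diagonals_incongruent\<close>).

  That a toroidal solution has size coprime to \<open>6\<close> is Polya's theorem
  (\<open>toroidal_solution_coprime_6\<close>). Modulo \<open>N\<close>, its diagonal numbers run through all residues
  once, so their power sums agree with those of \<open>1..N\<close>. This gives
  \<open>0 = (\<Sum>j. B j - j) \<equiv> (\<Sum>j. j)\<close>, hence \<open>N\<close> is odd, and
  \<open>4 * (\<Sum>j. j\<^sup>2) = (\<Sum>j. (B j - j)\<^sup>2 + (- B j - j)\<^sup>2) \<equiv> 2 * (\<Sum>j. j\<^sup>2)\<close>, hence \<open>3\<close> does not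
  divide \<open>N\<close>.

  The converse fails because a solution of size \<open>7\<close> need not be toroidal: two diagonals of \<open>B\<close>
  that are \<open>7\<close> apart then produce an attack in \<open>A \<otimes> B\<close> in the way just described, for which an
  \<open>A\<close> of size \<open>4\<close> suffices.
\<close>

section \<open>Diagonals of a solution\<close>

text \<open>The sign \<open>s\<close> is \<open>1\<close> or \<open>-1\<close> and selects one of the two directions of diagonals, so that
  both are treated by the same argument.\<close>

definition diag :: "int \<Rightarrow> (nat \<Rightarrow> nat) \<Rightarrow> nat \<Rightarrow> int" where
  "diag s A i = s * int (A i) - int i"

lemma queens_solution_range:
  assumes "queens_solution N A" "i \<in> {1..N}"
  shows "1 \<le> A i" "A i \<le> N"
  using assms permutes_in_image[of A "{1..N}" i] by (auto simp: queens_solution_def)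

lemma queens_solution_inj_diag:
  assumes A: "queens_solution N A" and s: "s \<in> {1, -1}"
  shows "inj_on (diag s A) {1..N}"
proof (rule linorder_inj_onI)
  fix i j assume "i < j" "i \<in> {1..N}" "j \<in> {1..N}"
  then have "\<bar>int i - int j\<bar> \<noteq> \<bar>int (A i) - int (A j)\<bar>"
    using A by (auto simp: queens_solution_def)
  then show "diag s A i \<noteq> diag s A j"
    using s by (auto simp: diag_def)
qed auto

text \<open>\<open>M\<close> diagonals out of the \<open>2 * M - 1\<close> available ones can avoid being neighbours only by taking
  every other one, and in particular the two extreme ones. These are single corners of the board,
  opposite to each other, so their queens would attack each other along the other diagonal.\<close>

lemma neighbouring_diagonals:
  assumes A: "queens_solution M A" and M: "1 < M" and s: "s \<in> {1, -1}"
  obtains i i' where "i \<in> {1..M}" "i' \<in> {1..M}" "diag s A i = diag s A i' + 1"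
proof (rule ccontr)
  assume "\<not> thesis"
  define D where "D = diag s A ` {1..M}"
  \<comment> \<open>the number of the main diagonal, in the middle between the two extreme ones\<close>
  define c where "c = (if s = 1 then 0 else - int M - 1)"
  let ?R = "{c - int M + 1..c + int M}"
  have disj: "D \<inter> (+) 1 ` D = {}"
    using that \<open>\<not> thesis\<close> by (force simp: D_def add.commute)
  have range: "D \<subseteq> {c - int M + 1..c + int M - 1}"
  proof
    fix d assume "d \<in> D"
    then obtain i where i: "i \<in> {1..M}" "d = diag s A i" by (auto simp: D_def)
    then show "d \<in> {c - int M + 1..c + int M - 1}"
      using queens_solution_range[OF A i(1)] s by (auto simp: diag_def c_def)
  qed
  have card: "card D = M"
    unfolding D_def using card_image[OF queens_solution_inj_diag[OF A s]] by simp
  have fin: "finite D" by (simp add: D_def)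
  \<comment> \<open>\<open>D\<close> and its shift by one have \<open>2 * M\<close> elements together, which fill \<open>?R\<close>; the ends of
    \<open>?R\<close> can only come from the extreme diagonals.\<close>
  have "card (D \<union> (+) 1 ` D) = card ?R"
    using card fin disj by (simp add: card_Un_disjoint card_image)
  moreover have sub: "D \<union> (+) 1 ` D \<subseteq> ?R" using range by fastforce
  ultimately have full: "D \<union> (+) 1 ` D = ?R" by (intro card_subset_eq) auto
  have "c - int M + 1 \<in> D"
  proof -
    have "c - int M + 1 \<in> D \<union> (+) 1 ` D" unfolding full using M by simp
    then show ?thesis using range by fastforce
  qed
  then obtain i where i: "i \<in> {1..M}" "diag s A i = c - int M + 1" by (auto simp: D_def)
  have "c + int M - 1 \<in> D"
  proof -
    have "c + int M \<in> D \<union> (+) 1 ` D" unfolding full using M by simp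
    then show ?thesis using range by fastforce
  qed
  then obtain j where j: "j \<in> {1..M}" "diag s A j = c + int M - 1" by (auto simp: D_def)
  have "diag (- s) A i = diag (- s) A j"
    using i j s queens_solution_range[OF A i(1)] queens_solution_range[OF A j(1)]
    by (auto simp: diag_def c_def)
  then have "i = j"
    using inj_onD[OF queens_solution_inj_diag[OF A, of "- s"] _ i(1) j(1)] s by auto
  then show False using i(2) j(2) M by simp
qed

section \<open>Diagonals of a composition\<close>

lemma diag_queens_comp:
  assumes "queens_solution M A" "i \<in> {1..M}" "j \<in> {1..N}"
  shows "diag s (queens_comp M A N B) (N * (i - 1) + j)
       = int N * (diag s A i - s + 1) + diag s B j"
proof -
  have comp: "queens_comp M A N B (N * (i - 1) + j) = N * (A i - 1) + B j"
    using assms by (intro queens_comp_eq) auto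
  obtain a where a: "i = Suc a" using assms(2) by (cases i) auto
  obtain b where b: "A i = Suc b"
    using queens_solution_range(1)[OF assms(1,2)] by (cases "A i") auto
  show ?thesis
    unfolding diag_def comp b by (simp add: a algebra_simps)
qed

text \<open>Two congruent diagonal numbers of \<open>B\<close> differ by \<open>0\<close> or \<open>\<plusminus>N\<close>. In the first case the queens
  attack each other on \<open>B\<close>. In the second, the one on the higher diagonal is placed into the copy
  of \<open>B\<close> on the lower of two neighbouring diagonals of \<open>A\<close>, and the other one into the other
  copy: by \<open>diag_queens_comp\<close> they share a diagonal of \<open>A \<otimes> B\<close>.\<close>

lemma diagonals_incongruent:
  assumes A: "queens_solution M A" and M: "1 < M" and B: "queens_solution N B"
    and C: "queens_solution (M * N) (queens_comp M A N B)" and s: "s \<in> {1, -1}"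
  shows "inj_on (\<lambda>j. diag s B j mod int N) {1..N}"
proof (rule inj_onI, rule ccontr)
  let ?C = "queens_comp M A N B"
  obtain i i' where i: "i \<in> {1..M}" "i' \<in> {1..M}" "diag s A i = diag s A i' + 1"
    using neighbouring_diagonals[OF A M s] .
  have apart: False if j: "j \<in> {1..N}" "j' \<in> {1..N}" "diag s B j' = diag s B j + int N" for j j'
  proof -
    let ?k = "N * (i - 1) + j" and ?k' = "N * (i' - 1) + j'"
    have in_board: "N * (a - 1) + b \<in> {1..M * N}" if "a \<in> {1..M}" "b \<in> {1..N}" for a b
    proof -
      have "N * (a - 1) + b \<le> N * (a - 1) + N * 1" using that by simp
      also have "\<dots> = N * a" using that by (cases a) auto
      also have "\<dots> \<le> M * N" using that by simp
      finally show ?thesis using that by simp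
    qed
    have "diag s ?C ?k = diag s ?C ?k'"
      unfolding diag_queens_comp[OF A i(1) j(1)] diag_queens_comp[OF A i(2) j(2)]
      using i(3) j(3) by (simp add: algebra_simps)
    then have "?k = ?k'"
      using queens_solution_inj_diag[OF C s] in_board[OF i(1) j(1)] in_board[OF i(2) j(2)]
      by (auto dest: inj_onD)
    then have "(?k - 1) div N = (?k' - 1) div N" by simp
    moreover have "(N * (a - 1) + b - 1) div N = a - 1" if "b \<in> {1..N}" for a b
    proof -
      have "N * (a - 1) + b - 1 = (b - 1) + N * (a - 1)" "b - 1 < N" using that by auto
      then show ?thesis by simp
    qed
    ultimately have "i = i'" using i(1,2) j(1,2) by auto
    then show False using i(3) by simp
  qed
  fix j j' assume j: "j \<in> {1..N}" "j' \<in> {1..N}" "diag s B j mod int N = diag s B j' mod int N"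
    and "j \<noteq> j'"
  then have "diag s B j \<noteq> diag s B j'"
    using queens_solution_inj_diag[OF B s] by (auto dest: inj_onD)
  moreover obtain t where t: "diag s B j - diag s B j' = int N * t"
    using j(3) by (metis mod_eq_dvd_iff dvdE)
  ultimately have "t \<noteq> 0" by auto
  moreover have "\<bar>int N * t\<bar> < int N * 2"
    unfolding t[symmetric]
    using s queens_solution_range[OF B j(1)] queens_solution_range[OF B j(2)] j(1,2)
    by (auto simp: diag_def)
  then have "\<bar>t\<bar> < 2" using j(1) by (simp add: abs_mult mult_less_cancel_left_pos)
  ultimately have "t = 1 \<or> t = -1" by auto
  then show False using t apart[OF j(1,2)] apart[OF j(2,1)] by auto
qed

section \<open>Solutions on the torus\<close>

lemma sum_powers_incongruent:
  fixes f :: "nat \<Rightarrow> int"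
  assumes "inj_on (\<lambda>j. f j mod int N) {1..N}"
  shows "[(\<Sum>j=1..N. f j ^ p) = (\<Sum>k\<in>{0..<int N}. k ^ p)] (mod int N)"
proof (cases "N = 0")
  case False
  let ?g = "\<lambda>j. f j mod int N"
  have "?g ` {1..N} = {0..<int N}"
    using False card_image[OF assms] by (intro card_subset_eq) auto
  then have "(\<Sum>k\<in>{0..<int N}. k ^ p) = (\<Sum>j=1..N. ?g j ^ p)"
    using sum.reindex[OF assms, of "\<lambda>k. k ^ p"] by simp
  moreover have "[(\<Sum>j=1..N. f j ^ p) = (\<Sum>j=1..N. ?g j ^ p)] (mod int N)"
    by (intro cong_sum cong_pow) (simp add: cong_def)
  ultimately show ?thesis by simp
qed simp

lemma sum_powers_complete_residues:
  fixes f :: "nat \<Rightarrow> int"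
  assumes "inj_on (\<lambda>j. f j mod int N) {1..N}"
  shows "[(\<Sum>j=1..N. f j ^ p) = (\<Sum>j=1..N. int j ^ p)] (mod int N)"
proof -
  have "inj_on (\<lambda>j. int j mod int N) {1..N}"
  proof (rule linorder_inj_onI)
    fix i j assume ij: "i < j" "i \<in> {1..N}" "j \<in> {1..N}"
    show "int i mod int N \<noteq> int j mod int N"
    proof
      assume "int i mod int N = int j mod int N"
      then have "int N dvd int j - int i" by (metis mod_eq_dvd_iff)
      then have "int N \<le> int j - int i" using ij by (intro zdvd_imp_le) auto
      then show False using ij by auto
    qed
  qed auto
  from sum_powers_incongruent[OF this] sum_powers_incongruent[OF assms]
  show ?thesis by (metis cong_sym cong_trans)
qed

lemma sum_first_integers: "2 * (\<Sum>j=1..N. int j) = int N * (int N + 1)"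
  by (induction N) (auto simp: algebra_simps)

lemma sum_first_squares: "6 * (\<Sum>j=1..N. int j ^ 2) = int N * (int N + 1) * (2 * int N + 1)"
  by (induction N) (auto simp: algebra_simps power2_eq_square)

text \<open>The first powers, in one direction, exclude the divisor \<open>2\<close>. For the divisor \<open>3\<close>, adding the
  squares of both directions cancels the mixed terms \<open>B j * j\<close>, about which nothing is known.\<close>

lemma toroidal_solution_coprime_6:
  assumes B: "B permutes {1..N}" and N: "1 \<le> N"
    and inj: "\<And>s. s \<in> {1, -1} \<Longrightarrow> inj_on (\<lambda>j. diag s B j mod int N) {1..N}"
  shows "gcd N 6 = 1"
proof -
  let ?S = "\<lambda>p. \<Sum>j=1..N. int j ^ p"
  have perm: "(\<Sum>j=1..N. int (B j) ^ p) = ?S p" for p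
    using sum.permute[OF B, of "\<lambda>j. int j ^ p"] by (simp add: o_def)
  have "(\<Sum>j=1..N. diag 1 B j ^ 1) = 0"
    using perm[of 1] by (simp add: diag_def sum_subtractf)
  then have "int N dvd ?S 1"
    using sum_powers_complete_residues[OF inj[of 1], of 1] by (simp add: cong_def mod_eq_0_iff_dvd)
  then obtain t where t: "?S 1 = int N * t" ..
  have "int N * (int N + 1) = 2 * ?S 1"
    using sum_first_integers[of N] by simp
  also have "\<dots> = int N * (2 * t)" unfolding t by simp
  finally have "int N + 1 = 2 * t" using N by simp
  then have odd: "\<not> 2 dvd N" by presburger
  have "(\<Sum>j=1..N. diag 1 B j ^ 2) + (\<Sum>j=1..N. diag (-1) B j ^ 2)
      = (\<Sum>j=1..N. 2 * int (B j) ^ 2 + 2 * int j ^ 2)"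
    unfolding sum.distrib[symmetric]
    by (intro sum.cong) (auto simp: diag_def power2_eq_square algebra_simps)
  also have "\<dots> = 4 * ?S 2"
    using perm[of 2] by (simp add: sum.distrib flip: sum_distrib_left)
  finally have "[4 * ?S 2 = ?S 2 + ?S 2] (mod int N)"
    using cong_add[OF sum_powers_complete_residues[OF inj[of 1], of 2]
        sum_powers_complete_residues[OF inj[of "-1"], of 2]] by simp
  then have "int N dvd 2 * ?S 2" by (simp add: cong_iff_dvd_diff)
  then obtain u where u: "2 * ?S 2 = int N * u" ..
  have "int N * ((int N + 1) * (2 * int N + 1)) = 3 * (2 * ?S 2)"
    using sum_first_squares[of N] by (simp add: mult.assoc)
  also have "\<dots> = int N * (3 * u)" unfolding u by simp
  finally have three: "(int N + 1) * (2 * int N + 1) = 3 * u" using N by simp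
  have "\<not> 3 dvd N"
  proof
    assume "3 dvd N"
    then obtain k where "N = 3 * k" ..
    then have "1 = 3 * (u - 6 * int k * int k - 3 * int k)"
      using three by (simp add: algebra_simps)
    then show False by presburger
  qed
  then have "coprime N 3"
    using prime_imp_coprime[of 3 N] by (simp add: coprime_commute)
  moreover have "coprime N 2" using odd by (simp add: coprime_right_2_iff_odd)
  ultimately have "coprime N (2 * 3)" unfolding coprime_mult_right_iff by blast
  then show ?thesis by (simp add: coprime_iff_gcd_eq_1)
qed

section \<open>Arrangements given by lists\<close>

definition arrangement_of_list :: "nat list \<Rightarrow> nat \<Rightarrow> nat" where
  "arrangement_of_list xs k = (if k \<in> {1..length xs} then xs ! (k - 1) else k)"

lemma queens_solution_arrangement_of_list:
  assumes "xs \<noteq> []" "distinct xs" "set xs = {1..length xs}"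
    and free: "\<forall>j<length xs. \<forall>i<j. int j - int i \<noteq> \<bar>int (xs ! i) - int (xs ! j)\<bar>"
  shows "queens_solution (length xs) (arrangement_of_list xs)"
proof -
  let ?f = "arrangement_of_list xs" and ?I = "{1..length xs}"
  have "?f ` ?I \<subseteq> ?I"
    using assms(3) nth_mem[of _ xs] by (force simp: arrangement_of_list_def)
  moreover have "inj_on ?f ?I"
    using assms(2) by (auto simp: inj_on_def arrangement_of_list_def nth_eq_iff_index_eq)
  ultimately have "bij_betw ?f ?I ?I"
    by (simp add: bij_betw_def endo_inj_surj)
  then have "?f permutes ?I"
    by (rule bij_imp_permutes) (auto simp: arrangement_of_list_def)
  moreover have "\<bar>int i - int j\<bar> \<noteq> \<bar>int (?f i) - int (?f j)\<bar>"
    if "1 \<le> i" "i < j" "j \<le> length xs" for i j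
    using free[rule_format, of "j - 1" "i - 1"] that
    by (auto simp: arrangement_of_list_def of_nat_diff)
  ultimately show ?thesis
    using assms(1) by (auto simp: queens_solution_def Suc_le_eq)
qed

section \<open>Compositions that are solutions\<close>

theorem corollary2p5:
  shows "(\<forall>M N A B.
            queens_solution M A \<and> queens_solution N B \<and> 1 < M \<and>
            queens_solution (M * N) (queens_comp M A N B) \<longrightarrow> gcd N 6 = 1) \<and>
         \<not> (\<forall>M N A B.
            queens_solution M A \<and> queens_solution N B \<and> gcd N 6 = 1 \<longrightarrow>
            queens_solution (M * N) (queens_comp M A N B))"
proof
  show "\<forall>M N A B.
      queens_solution M A \<and> queens_solution N B \<and> 1 < M \<and>
      queens_solution (M * N) (queens_comp M A N B) \<longrightarrow> gcd N 6 = 1"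
  proof (intro allI impI, elim conjE)
    fix M N A B
    assume A: "queens_solution M A" and B: "queens_solution N B" and M: "1 < M"
      and C: "queens_solution (M * N) (queens_comp M A N B)"
    show "gcd N 6 = 1"
      using B diagonals_incongruent[OF A M B C]
      by (intro toroidal_solution_coprime_6[of B]) (auto simp: queens_solution_def)
  qed
next
  let ?A = "arrangement_of_list [2, 4, 1, 3]"
  let ?B = "arrangement_of_list [2, 4, 1, 7, 5, 3, 6]"
  let ?C = "queens_comp 4 ?A 7 ?B"
  have "queens_solution (length [2, 4, 1, 3 :: nat]) ?A"
    by (rule queens_solution_arrangement_of_list) code_simp+
  then have A: "queens_solution 4 ?A" by (simp add: eval_nat_numeral)
  have "queens_solution (length [2, 4, 1, 7, 5, 3, 6 :: nat]) ?B"
    by (rule queens_solution_arrangement_of_list) code_simp+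
  then have B: "queens_solution 7 ?B" by (simp add: eval_nat_numeral)
  \<comment> \<open>On the board \<open>?B\<close>, the squares \<open>(5, 5)\<close> and \<open>(1, 2)\<close> have coordinate sums \<open>10\<close> and \<open>3\<close>,
    exactly \<open>7\<close> apart. Copied to the squares \<open>(1, 2)\<close> and \<open>(3, 1)\<close> of \<open>?A\<close>, with
    coordinate sums \<open>3\<close> and \<open>4\<close>, they attack each other.\<close>
  have "?C 5 = 12" "?C 15 = 2"
    by (simp_all add: queens_comp_def arrangement_of_list_def)
  then have "\<bar>int 5 - int 15\<bar> = \<bar>int (?C 5) - int (?C 15)\<bar>" by simp
  moreover have "(1::nat) \<le> 5" "(5::nat) < 15" "(15::nat) \<le> 4 * 7" by simp_all
  ultimately have "\<not> queens_solution (4 * 7) ?C"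
    unfolding queens_solution_def by blast
  moreover have "gcd 7 6 = (1::nat)" by (simp add: gcd_non_0_nat)
  ultimately show "\<not> (\<forall>M N A B.
      queens_solution M A \<and> queens_solution N B \<and> gcd N 6 = 1 \<longrightarrow>
      queens_solution (M * N) (queens_comp M A N B))"
    using A B by metis
qed

end
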